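(* Let $a,b,s$ and $c_1,\dots,c_s$ be positive integers, and let $v$ be a positive integer with $v>b+c_i$ for all $1\le i\le s$. Put $C=\sum_{i=1}^s a^{c_i}+1$. Let $t$ be a positive integer, which is arbitrary if $a^v>C$, and which satisfies $a^vt>C$ if $a^v<C$. Then $$\frac{a^b}{a^vt-C}=\frac{1}{a^{v-b}t}+\sum_{i=1}^{s}\frac{1}{a^{v-(b+c_i)}\,t\,(a^vt-C)}+\frac{1}{a^{v-b}\,t\,(a^vt-C)} .$$
   Context: The identity is between rational numbers. The case $a^v=C$ is not covered by the statement. *)

theory Defs
  imports Complex_Main
begin

end

theory Submission
  imports Defs
begin

text \<open>
  Over the common denominator \<open>a\<^sup>v t D\<close>, where \<open>D = a\<^sup>v t - C\<close>, the numerators on the right are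
  \<open>a\<^sup>b D\<close>, the products \<open>a\<^sup>b a\<^bsup>c i\<^esup>\<close>, and \<open>a\<^sup>b\<close>. They add up to \<open>a\<^sup>b (D + C) = a\<^sup>b (a\<^sup>v t)\<close>, because \<open>C\<close>
  is the sum of the powers \<open>a\<^bsup>c i\<^esup>\<close> plus one; cancelling \<open>a\<^sup>v t\<close> leaves the left-hand side.
  This computation is valid in every field (\<open>unit_fraction_expansion\<close>). For the integers
  at hand it remains to see that \<open>D\<close> is nonzero: both alternatives of the last hypothesis give
  \<open>a\<^sup>v t > C\<close>, the first one because \<open>t\<close> is at least one.
\<close>

lemma inverse_power_diff:
  fixes x :: "'a :: field"
  assumes "x \<noteq> 0" and "k \<le> v"
  shows "1 / x ^ (v - k) = x ^ k / x ^ v"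
  using assms by (simp add: power_diff)

text \<open>
  With \<open>x\<^sup>b / (x\<^sup>v T D)\<close> factored out, \<open>D = x\<^sup>v T - C\<close>, the first fraction contributes \<open>D\<close> and the
  remaining ones contribute exactly the terms \<open>x\<^bsup>c i\<^esup>\<close> and \<open>1\<close> that make up \<open>C\<close>.
\<close>

lemma unit_fraction_expansion:
  fixes x T C :: "'a :: field" and c :: "'i \<Rightarrow> nat"
  assumes x: "x \<noteq> 0" and T: "T \<noteq> 0" and D: "x ^ v * T - C \<noteq> 0"
    and C: "C = (\<Sum>i\<in>I. x ^ c i) + 1"
    and b: "b \<le> v" and c: "\<And>i. i \<in> I \<Longrightarrow> b + c i \<le> v"
  shows "x ^ b / (x ^ v * T - C) =
    1 / (x ^ (v - b) * T)
    + (\<Sum>i\<in>I. 1 / (x ^ (v - (b + c i)) * T * (x ^ v * T - C)))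
    + 1 / (x ^ (v - b) * T * (x ^ v * T - C))"
proof -
  define D where "D = x ^ v * T - C"
  have nz: "D \<noteq> 0" "x ^ v \<noteq> 0"
    using D x by (simp_all add: D_def)
  have split: "1 / (x ^ (v - k) * y) = x ^ k / (x ^ v * y)" if "k \<le> v" for k y
    using inverse_power_diff[OF x that]
    by (metis divide_divide_eq_left)
  have "(\<Sum>i\<in>I. 1 / (x ^ (v - (b + c i)) * (T * D)))
      = (\<Sum>i\<in>I. x ^ b / (x ^ v * (T * D)) * x ^ c i)"
    by (intro sum.cong refl) (simp add: split c power_add)
  also have "\<dots> = x ^ b / (x ^ v * (T * D)) * (C - 1)"
    by (simp add: C sum_distrib_left)
  finally have tail: "(\<Sum>i\<in>I. 1 / (x ^ (v - (b + c i)) * (T * D)))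
      = x ^ b / (x ^ v * (T * D)) * (C - 1)" .
  have "1 / (x ^ (v - b) * T) + x ^ b / (x ^ v * (T * D)) * (C - 1)
      + 1 / (x ^ (v - b) * (T * D))
      = x ^ b * (D + C) / (x ^ v * T * D)"
    using nz T x by (simp add: split b divide_simps) (simp add: algebra_simps)
  also have "\<dots> = x ^ b / D"
    using nz T by (simp add: D_def)
  finally show ?thesis
    by (simp add: tail mult.assoc flip: D_def)
qed

theorem theorem5p1:
  fixes a b s v t C :: nat
    and c :: "nat \<Rightarrow> nat"
  assumes "a > 0" and "b > 0" and "s > 0"
    and "\<And>i. i \<in> {1..s} \<Longrightarrow> c i > 0"
    and "v > 0"
    and "\<And>i. i \<in> {1..s} \<Longrightarrow> v > b + c i"
    and "C = (\<Sum>i=1..s. a ^ c i) + 1"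
    and "t > 0"
    and "a ^ v > C \<or> (a ^ v < C \<and> a ^ v * t > C)"
  shows "(of_nat a ^ b :: rat) / (of_nat a ^ v * of_nat t - of_nat C) =
    1 / (of_nat a ^ (v - b) * of_nat t)
    + (\<Sum>i=1..s. 1 / (of_nat a ^ (v - (b + c i)) * of_nat t * (of_nat a ^ v * of_nat t - of_nat C)))
    + 1 / (of_nat a ^ (v - b) * of_nat t * (of_nat a ^ v * of_nat t - of_nat C))"
proof (rule unit_fraction_expansion)
  show "(of_nat a :: rat) \<noteq> 0" and "(of_nat t :: rat) \<noteq> 0"
    using \<open>a > 0\<close> \<open>t > 0\<close> by simp_all
  have "a ^ v \<le> a ^ v * t"
    using \<open>t > 0\<close> by simp
  with assms(9) have "C < a ^ v * t"
    by linarith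
  then have "(of_nat C :: rat) < of_nat (a ^ v * t)"
    by (simp only: of_nat_less_iff)
  then show "(of_nat a :: rat) ^ v * of_nat t - of_nat C \<noteq> 0"
    by simp
  show "(of_nat C :: rat) = (\<Sum>i=1..s. of_nat a ^ c i) + 1"
    using assms(7) by simp
  \<comment> \<open>The bound on \<open>v\<close> speaks only about indices, so an index has to exist.\<close>
  have "1 \<in> {1..s}"
    using \<open>s > 0\<close> by simp
  from assms(6)[OF this] show "b \<le> v"
    by linarith
  show "b + c i \<le> v" if "i \<in> {1..s}" for i
    using assms(6)[OF that] by linarith
qed

end
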